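(* Consider speculative decoding with $K$ drafters satisfying the stationarity assumption stated in the context, let $i^\star$ be the optimal drafter and let $i\neq i^\star$ be any suboptimal drafter. Put $\Delta(\alpha_i)=\alpha_{i^\star}-\alpha_i$ and $n=N_{max}$. Define on $(0,1)$ the functions $f_n(x)=\frac{x-x^{n+1}}{1-x}$, $g_n(x)=f_n'(x)=\sum_{s=1}^{n}s x^{s-1}$ and $h_n(x)=\sum_{s=1}^{n}s\,(x^{s-1}-x^{2n-s})$. Then $$R(r_i^{BD})\ \geq\ 4\,(\Delta(\alpha_i))^2 N_{max}.$$ Moreover, for any drafter configuration satisfying $h_n(\alpha_{i^\star})\geq \frac{g_n(\alpha_{i^\star})^2}{4n\,\alpha_{i^\star}}$ and $\mathrm{Var}[r_i^{BE}]<\mathrm{Var}[r_{i^\star}^{BE}]$, $$R(r_i^{BD})>R(r_i^{BE}).$$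
   Context: Speculative decoding model. There is a target model and $K$ drafters indexed by $[K]$. Given a prefix, $p^t(\cdot|x^{1:t-1})$ and $q_i^t(\cdot|x^{1:t-1})$ are the next-token distributions of the target and of drafter $i$. In a round with drafter $i$, $N_{max}$ candidate tokens are drafted and verified in order until the first rejection; a candidate, given that all previous ones of the round were accepted, is accepted with probability $1-d_{TV}(p,q_i)$ at its position ($d_{TV}$ is total variation distance). $N_{acc}(i,t)\in\{0,\dots,N_{max}\}$ is the number of accepted candidates in round $t$. Stationarity assumption: $\alpha_{i,t}=1-d_{TV}(p^t(\cdot|x^{1:t-1}),q_i^t(\cdot|x^{1:t-1}))$ are i.i.d. from a distribution $\nu_i$ with mean $\alpha_i$, for every $i\in[K]$. Rewards: $r_{i,t}^{BE}=N_{acc}(i,t)/N_{max}$ (block efficiency), and $r_{i,t}^{BD}=\frac1{N_{max}}\sum_{j=0}^{N_{max}-1}(1-d_{TV}(p^{l(t)+j},q_i^{l(t)+j}))$ (block divergence), where $l(t)$ is the number of input tokens at round $t$ and $p^l,q_i^l$ are the next-token distributions given $x^{1:l}$. $r_i^{BE}$, $r_i^{BD}$ denote random variables with the corresponding distributions. Feedback signal: for a reward design $r_i$ with $\mu_i=\mathbb{E}[r_i]$, $i^\star=\arg\max_i\mu_i$ (for both rewards this is also $\arg\max_i\alpha_i$) and $\Delta_i=\mu_{i^\star}-\mu_i$, for each suboptimal $i\ne i^\star$, $R(r_i)=\dfrac{\Delta_i^2}{\max(\mathrm{Var}[r_i],\mathrm{Var}[r_{i^\star}])}$.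
   Formalization: The strict inequality R(BD)>R(BE) is claimed except when N_max=1 and ν of the optimal drafter is supported on {0,1}; there it is false (both signals equal 4Δ², e.g. ν Bernoulli(1/2)) and only ≥ is claimed. *)

theory Defs
  imports "HOL-Probability.Probability"
begin

definition tv_dist :: "'v pmf \<Rightarrow> 'v pmf \<Rightarrow> real" where
  "tv_dist p q = (SUP A. \<bar>measure_pmf.prob p A - measure_pmf.prob q A\<bar>)"

text \<open>
  Drafters are indexed by \<open>{1..num_drafters}\<close>. The pmf \<open>target xs\<close> (\<open>drafter i xs\<close>) is the
  next-token distribution of the target model (of drafter \<open>i\<close>) given the prefix \<open>xs\<close>; a position
  superscript is redundant, since the position is determined by the length of the prefix. The token
  at position \<open>s \<ge> 1\<close> is the random quantity \<open>token s\<close>, and the first \<open>prompt_len\<close> tokens are the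
  prompt. The number of input tokens \<open>input_len t\<close> of round \<open>t\<close> may be random, because it depends
  on what was accepted in earlier rounds. The value \<open>n_acc i t\<close> is the number of accepted
  candidates if drafter \<open>i\<close> is used in round \<open>t\<close>.
\<close>

record ('w, 'v) spec_decoding =
  outcomes :: "'w measure"
  num_drafters :: nat
  n_max :: nat
  target :: "'v list \<Rightarrow> 'v pmf"
  drafter :: "nat \<Rightarrow> 'v list \<Rightarrow> 'v pmf"
  token :: "nat \<Rightarrow> 'w \<Rightarrow> 'v"
  prompt_len :: nat
  input_len :: "nat \<Rightarrow> 'w \<Rightarrow> nat"
  n_acc :: "nat \<Rightarrow> nat \<Rightarrow> 'w \<Rightarrow> nat"
  rate_law :: "nat \<Rightarrow> real measure"

definition token_prefix :: "('w, 'v) spec_decoding \<Rightarrow> nat \<Rightarrow> 'w \<Rightarrow> 'v list" where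
  "token_prefix S l \<omega> = map (\<lambda>s. token S s \<omega>) [1..<Suc l]"

text \<open>
  The index \<open>l\<close> of \<open>accept_rate S i l\<close> is the length of the prefix that is conditioned on, so this
  is the acceptance probability at position \<open>l + 1\<close>, usually written \<open>\<alpha>\<^bsub>i,l+1\<^esub>\<close>.
\<close>

definition accept_rate :: "('w, 'v) spec_decoding \<Rightarrow> nat \<Rightarrow> nat \<Rightarrow> 'w \<Rightarrow> real" where
  "accept_rate S i l \<omega> =
     1 - tv_dist (target S (token_prefix S l \<omega>)) (drafter S i (token_prefix S l \<omega>))"

definition rate_block :: "('w, 'v) spec_decoding \<Rightarrow> nat \<Rightarrow> nat \<Rightarrow> 'w \<Rightarrow> nat \<Rightarrow> real" where
  "rate_block S i l \<omega> = (\<lambda>j\<in>{..<n_max S}. accept_rate S i (l + j) \<omega>)"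

definition mean_rate :: "('w, 'v) spec_decoding \<Rightarrow> nat \<Rightarrow> real" where
  "mean_rate S i = (\<integral>a. a \<partial>rate_law S i)"

text \<open>
  The information available when candidate \<open>j\<close> (counted from 0) of round \<open>t\<close> is verified: the
  acceptance probabilities at the positions of the round, and whether all earlier candidates of the
  round were accepted.
\<close>

definition verification_info ::
    "('w, 'v) spec_decoding \<Rightarrow> nat \<Rightarrow> nat \<Rightarrow> nat \<Rightarrow> 'w measure" where
  "verification_info S i t j =
     vimage_algebra (space (outcomes S))
       (\<lambda>\<omega>. (rate_block S i (input_len S t \<omega>) \<omega>, j \<le> n_acc S i t \<omega>))
       (Pi\<^sub>M {..<n_max S} (\<lambda>_. borel) \<Otimes>\<^sub>M count_space UNIV)"

text \<open>
  The assumptions \<open>rates_indep\<close> and \<open>rates_law\<close> are stationarity: for each drafter the acceptance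
  probabilities at the positions after the prompt are i.i.d. with law \<open>rate_law S i\<close>. The assumption
  \<open>input_len_nonanticipating\<close> says that whether round \<open>t\<close> starts after \<open>l\<close> tokens is not
  influenced by the acceptance probabilities at the positions \<open>l + 1, \<dots>, l + n_max S\<close>; it is
  trivially true if \<open>input_len S t\<close> is not random.
  In \<open>verification\<close>, candidate \<open>j\<close> is accepted iff \<open>j < n_acc S i t \<omega>\<close>, and it is reached iff
  \<open>j \<le> n_acc S i t \<omega>\<close>.
\<close>

locale speculative_decoding = prob_space "outcomes S"
  for S :: "('w, 'v) spec_decoding" +
  assumes n_max_pos: "n_max S \<ge> 1"
    and rates_indep: "i \<in> {1..num_drafters S} \<Longrightarrow>
      indep_vars (\<lambda>_. borel) (accept_rate S i) {prompt_len S..}"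
    and rates_law: "i \<in> {1..num_drafters S} \<Longrightarrow> l \<ge> prompt_len S \<Longrightarrow>
      distr (outcomes S) borel (accept_rate S i l) = rate_law S i"
    and input_len_measurable: "input_len S t \<in> measurable (outcomes S) (count_space UNIV)"
    and input_len_ge: "\<omega> \<in> space (outcomes S) \<Longrightarrow> prompt_len S \<le> input_len S t \<omega>"
    and input_len_nonanticipating: "i \<in> {1..num_drafters S} \<Longrightarrow> l \<ge> prompt_len S \<Longrightarrow>
      B \<in> sets (Pi\<^sub>M {..<n_max S} (\<lambda>_. borel)) \<Longrightarrow>
      indep_event {\<omega> \<in> space (outcomes S). input_len S t \<omega> = l}
                  {\<omega> \<in> space (outcomes S). rate_block S i l \<omega> \<in> B}"
    and n_acc_measurable: "i \<in> {1..num_drafters S} \<Longrightarrow>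
      n_acc S i t \<in> measurable (outcomes S) (count_space UNIV)"
    and n_acc_le: "i \<in> {1..num_drafters S} \<Longrightarrow> \<omega> \<in> space (outcomes S) \<Longrightarrow>
      n_acc S i t \<omega> \<le> n_max S"
    and verification: "i \<in> {1..num_drafters S} \<Longrightarrow> j < n_max S \<Longrightarrow>
      AE \<omega> in outcomes S. j \<le> n_acc S i t \<omega> \<longrightarrow>
        real_cond_exp (outcomes S) (verification_info S i t j)
          (indicator {\<omega> \<in> space (outcomes S). j < n_acc S i t \<omega>}) \<omega>
        = accept_rate S i (input_len S t \<omega> + j) \<omega>"

definition block_efficiency :: "('w, 'v) spec_decoding \<Rightarrow> nat \<Rightarrow> nat \<Rightarrow> 'w \<Rightarrow> real" where
  "block_efficiency S i t \<omega> = real (n_acc S i t \<omega>) / real (n_max S)"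

definition block_divergence :: "('w, 'v) spec_decoding \<Rightarrow> nat \<Rightarrow> nat \<Rightarrow> 'w \<Rightarrow> real" where
  "block_divergence S i t \<omega> =
     (1 / real (n_max S)) *
       (\<Sum>j = 0..<n_max S.
          1 - tv_dist (target S (token_prefix S (input_len S t \<omega> + j) \<omega>))
                      (drafter S i (token_prefix S (input_len S t \<omega> + j) \<omega>)))"

text \<open>
  The signal is extended-real valued: a positive squared gap divided by zero variance is \<open>\<infinity>\<close>,
  whereas division by zero on the reals would give \<open>0\<close>.
\<close>

definition feedback_signal :: "'w measure \<Rightarrow> (nat \<Rightarrow> 'w \<Rightarrow> real) \<Rightarrow> nat \<Rightarrow> nat \<Rightarrow> ereal" where
  "feedback_signal M r istar i =
     ereal ((prob_space.expectation M (r istar) - prob_space.expectation M (r i))\<^sup>2) /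
     ereal (max (prob_space.variance M (r i)) (prob_space.variance M (r istar)))"

definition f_n :: "nat \<Rightarrow> real \<Rightarrow> real" where
  "f_n n x = (x - x ^ (n + 1)) / (1 - x)"

definition g_n :: "nat \<Rightarrow> real \<Rightarrow> real" where
  "g_n n x = (\<Sum>s = 1..n. real s * x ^ (s - 1))"

definition h_n :: "nat \<Rightarrow> real \<Rightarrow> real" where
  "h_n n x = (\<Sum>s = 1..n. real s * (x ^ (s - 1) - x ^ (2 * n - s)))"

lemma f_n_eq_sum:
  assumes "x \<noteq> 1"
  shows "f_n n x = (\<Sum>s = 1..n. x ^ s)"
proof -
  have "(1 - x) * (\<Sum>s = 1..n. x ^ s) = x - x ^ (n + 1)"
  proof (induction n)
    case (Suc n)
    have "(1 - x) * (\<Sum>s = 1..Suc n. x ^ s)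
        = (1 - x) * (\<Sum>s = 1..n. x ^ s) + (1 - x) * x ^ Suc n"
      by (simp add: distrib_left)
    also have "\<dots> = x - x ^ (Suc n + 1)"
      unfolding Suc.IH by (simp add: algebra_simps)
    finally show ?case .
  qed simp
  then show ?thesis
    using assms by (simp add: f_n_def field_simps)
qed

lemma f_n_has_derivative_g_n:
  assumes "x \<in> {0<..<1}"
  shows "(f_n n has_real_derivative g_n n x) (at x)"
proof -
  have "((\<lambda>x. \<Sum>s = 1..n. x ^ s) has_real_derivative g_n n x) (at x)"
    unfolding g_n_def by (auto intro!: derivative_eq_intros sum.cong)
  moreover have "eventually (\<lambda>y. f_n n y = (\<Sum>s = 1..n. y ^ s)) (nhds x)"
    using assms eventually_nhds_in_open[of "{0<..<1}" x]
    by (auto elim!: eventually_mono simp: f_n_eq_sum)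
  ultimately show ?thesis
    by (subst DERIV_cong_ev) auto
qed

end

theory Submission
  imports Defs
begin

text \<open>
  The acceptance rates at the positions of a round are again i.i.d., because the start of the round
  does not anticipate them. Hence the block divergence is a mean of \<open>n\<close> i.i.d. variables with values
  in \<open>[0,1]\<close>; its variance is at most \<open>\<alpha> (1 - \<alpha>) / n \<le> 1 / (4 n)\<close>, which gives the first bound.
  Candidate \<open>s\<close> is accepted with probability \<open>\<alpha>\<^sup>s\<close>, so the number of accepted candidates has mean
  \<open>f_n n \<alpha>\<close> and variance \<open>\<alpha> h_n n \<alpha>\<close>. As \<open>f_n n\<close> is convex with derivative \<open>g_n n\<close>, the assumption on
  \<open>h_n\<close> implies that the signal of the block efficiency is at most \<open>4 (\<Delta> \<alpha>)\<^sup>2 n\<close>. Strictness comes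
  from strict convexity if \<open>n \<ge> 2\<close>. If \<open>n = 1\<close> it comes from \<open>Var X < \<alpha> (1 - \<alpha>)\<close>, which fails only for
  rates \<open>X\<close> with values in \<open>{0, 1}\<close>.
\<close>

section \<open>Range of the acceptance rates\<close>

lemma tv_dist_nonneg: "0 \<le> tv_dist p q"
  and tv_dist_le_1: "tv_dist p q \<le> 1"
proof -
  have bound: "\<bar>measure_pmf.prob p A - measure_pmf.prob q A\<bar> \<le> 1" for A
    using measure_pmf.prob_le_1[of p A] measure_pmf.prob_le_1[of q A]
      measure_nonneg[of "measure_pmf p" A] measure_nonneg[of "measure_pmf q" A] by linarith
  then show "tv_dist p q \<le> 1"
    unfolding tv_dist_def by (intro cSUP_least) auto
  \<comment> \<open>The empty set contributes the value 0 to the supremum, which is therefore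
    nonnegative.\<close>
  have "\<bar>measure_pmf.prob p {} - measure_pmf.prob q {}\<bar> \<le> tv_dist p q"
    unfolding tv_dist_def by (intro cSUP_upper bdd_aboveI2[where M = 1] bound) auto
  then show "0 \<le> tv_dist p q"
    by simp
qed

lemma accept_rate_bounds: "0 \<le> accept_rate S i l \<omega>" "accept_rate S i l \<omega> \<le> 1"
  by (simp_all add: accept_rate_def tv_dist_nonneg tv_dist_le_1)

section \<open>Algebra of the power sums \<open>f_n\<close>, \<open>g_n\<close> and
  \<open>h_n\<close>\<close>

text \<open>Tangent inequality at \<open>b\<close> for the convex power sum, whose derivative is
  \<open>g_n n\<close>. In the factorisation of \<open>b ^ s - a ^ s\<close> by
  \<open>b - a\<close>, each of the \<open>s\<close> summands is at most
  \<open>b ^ (s - 1)\<close>.\<close>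

lemma power_sum_diff_le:
  assumes "0 \<le> a" "a < b"
  shows "(\<Sum>s = 1..n. b ^ s) - (\<Sum>s = 1..n. a ^ s) \<le> (b - a) * g_n n b"
    and "n \<ge> 2 \<Longrightarrow> (\<Sum>s = 1..n. b ^ s) - (\<Sum>s = 1..n. a ^ s) < (b - a) * g_n n b"
proof -
  have power_diff: "b ^ s - a ^ s = (b - a) * (\<Sum>k<s. b ^ k * a ^ (s - Suc k))" for s
    by (simp add: power_diff_sumr2 mult.commute)
  have term_le: "b ^ s - a ^ s \<le> (b - a) * (real s * b ^ (s - 1))" for s
  proof -
    have "b ^ k * a ^ (s - Suc k) \<le> b ^ (s - 1)" if "k < s" for k
    proof -
      have "b ^ k * a ^ (s - Suc k) \<le> b ^ k * b ^ (s - Suc k)"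
        using assms by (intro mult_left_mono power_mono) auto
      also have "\<dots> = b ^ (s - 1)"
        using that by (simp flip: power_add)
      finally show ?thesis .
    qed
    then have "(\<Sum>k<s. b ^ k * a ^ (s - Suc k)) \<le> real s * b ^ (s - 1)"
      using sum_mono[of "{..<s}" "\<lambda>k. b ^ k * a ^ (s - Suc k)" "\<lambda>_. b ^ (s - 1)"] by auto
    then show ?thesis
      unfolding power_diff using assms by (intro mult_left_mono) auto
  qed
  show "(\<Sum>s = 1..n. b ^ s) - (\<Sum>s = 1..n. a ^ s) \<le> (b - a) * g_n n b"
    unfolding g_n_def sum_distrib_left sum_subtractf[symmetric] by (intro sum_mono term_le)
  assume "n \<ge> 2"
  \<comment> \<open>The exponent 2 is the first strictly convex one: the secant slope
    \<open>b + a\<close> is below the tangent slope \<open>2 * b\<close>.\<close>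
  have "b ^ 2 - a ^ 2 < (b - a) * (real 2 * b ^ (2 - 1))"
    using mult_strict_left_mono[of a b "b - a"] assms by (simp add: power2_eq_square algebra_simps)
  then show "(\<Sum>s = 1..n. b ^ s) - (\<Sum>s = 1..n. a ^ s) < (b - a) * g_n n b"
    unfolding g_n_def sum_distrib_left sum_subtractf[symmetric] using \<open>n \<ge> 2\<close>
    by (intro sum_strict_mono_ex1 ballI term_le bexI[of _ 2]) auto
qed

text \<open>If \<open>P(N \<ge> s) = x ^ s\<close> for \<open>1 \<le> s \<le> n\<close> and
  \<open>N \<le> n\<close>, the left side is \<open>E N^2 - (E N)^2\<close>, because
  \<open>m^2\<close> is the sum of the first \<open>m\<close> odd numbers. All auxiliary identities
  avoid division by \<open>1 - x\<close>, so \<open>x = 1\<close> is covered.\<close>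

lemma second_moment_minus_square_eq_h_n:
  fixes x :: real
  shows "(\<Sum>s = 1..n. (2 * real s - 1) * x ^ s) - (\<Sum>s = 1..n. x ^ s)\<^sup>2 = x * h_n n x"
proof -
  have h: "x * h_n m x = (\<Sum>s = 1..m. real s * x ^ s) - (\<Sum>s = 1..m. real s * x ^ (2 * m + 1 - s))" for m
    unfolding h_n_def sum_distrib_left sum_subtractf[symmetric]
  proof (intro sum.cong refl)
    fix s assume "s \<in> {1..m}"
    then have "Suc (s - 1) = s" "Suc (2 * m - s) = 2 * m + 1 - s" by auto
    then have "x * x ^ (s - 1) = x ^ s" "x * x ^ (2 * m - s) = x ^ (2 * m + 1 - s)"
      by (metis power_Suc)+
    then show "x * (real s * (x ^ (s - 1) - x ^ (2 * m - s))) = real s * x ^ s - real s * x ^ (2 * m + 1 - s)"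
      by (simp only: right_diff_distrib mult.left_commute[of x])
  qed
  let ?F = "\<lambda>m. \<Sum>s = 1..m. x ^ s"
  let ?T = "\<lambda>m. \<Sum>s = 1..m. real s * x ^ (2 * m + 1 - s)"
  have F: "x * ?F m = ?F m + x ^ (m + 1) - x" for m
    by (induction m) (simp_all add: algebra_simps)
  \<comment> \<open>Passing from \<open>m\<close> to \<open>m + 1\<close> raises each exponent by 2
    and adds the summand \<open>s = m + 1\<close>, whose exponent is \<open>m + 2\<close>.\<close>
  have T_Suc: "?T (Suc m) = x\<^sup>2 * ?T m + real (m + 1) * x ^ (m + 2)" for m
  proof -
    have "x\<^sup>2 * x ^ (2 * m + 1 - s) = x ^ (2 * Suc m + 1 - s)" if "s \<in> {1..m}" for s
    proof -
      have "2 + (2 * m + 1 - s) = 2 * Suc m + 1 - s"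
        using that by auto
      then show ?thesis
        by (simp only: flip: power_add)
    qed
    then have "x\<^sup>2 * ?T m = (\<Sum>s = 1..m. real s * x ^ (2 * Suc m + 1 - s))"
      unfolding sum_distrib_left by (intro sum.cong refl) (metis mult.left_commute)
    then show ?thesis
      by simp
  qed
  have T: "x * ?T m = ?T m + x ^ (m + 1) * (?F m - real m)" for m
  proof (induction m)
    case (Suc m)
    have "x * ?T (Suc m) - ?T (Suc m) = x\<^sup>2 * (x * ?T m - ?T m) + (x - 1) * (real (m + 1) * x ^ (m + 2))"
      unfolding T_Suc by (simp add: algebra_simps)
    also have "\<dots> = x ^ (m + 2) * (x * ?F m - m * x + (x - 1) * real (m + 1))"
      unfolding Suc.IH by (simp add: algebra_simps power2_eq_square)
    also have "\<dots> = x ^ (Suc m + 1) * (?F (Suc m) - real (Suc m))"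
      unfolding F by (simp add: algebra_simps)
    finally show ?case
      by simp
  qed simp
  \<comment> \<open>Coefficient count in the square: \<open>k\<close> is a sum of two numbers from
    \<open>1..m\<close> in \<open>k - 1\<close> ways if \<open>k \<le> m\<close>, and in
    \<open>2 * m + 1 - k\<close> ways if \<open>m < k \<le> 2 * m\<close>; the latter terms form
    \<open>?T m\<close>.\<close>
  have "(?F m)\<^sup>2 = (\<Sum>s = 1..m. (real s - 1) * x ^ s) + ?T m" for m
  proof (induction m)
    case (Suc m)
    \<comment> \<open>Applying \<open>T\<close> twice removes the factor \<open>x^2\<close>, so that
      \<open>T_Suc\<close> can be matched with the induction hypothesis.\<close>
    have "x\<^sup>2 * ?T m = x * (x * ?T m)"
      by (simp add: power2_eq_square)
    also have "\<dots> = ?T m + x ^ (m + 1) * (?F m - real m) + x ^ (m + 1) * (x * ?F m - real m * x)"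
      by (subst T, subst distrib_left, subst T) (simp only: algebra_simps)
    also have "\<dots> = ?T m + x ^ (m + 1) * (2 * ?F m + x ^ (m + 1) - real m - x - real m * x)"
      unfolding F by (simp only: algebra_simps mult_2)
    finally have step: "x\<^sup>2 * ?T m = \<dots>" .
    have "(?F (Suc m))\<^sup>2 = (?F m)\<^sup>2 + x ^ (m + 1) * (2 * ?F m + x ^ (m + 1))"
      by (simp add: power2_eq_square algebra_simps)
    then show ?case
      unfolding Suc.IH T_Suc step by (simp add: algebra_simps)
  qed simp
  moreover have "(\<Sum>s = 1..n. (2 * real s - 1) * x ^ s)
      = (\<Sum>s = 1..n. real s * x ^ s) + (\<Sum>s = 1..n. (real s - 1) * x ^ s)"
    unfolding sum.distrib[symmetric] by (intro sum.cong refl) (simp add: algebra_simps)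
  ultimately have "(\<Sum>s = 1..n. (2 * real s - 1) * x ^ s) - (?F n)\<^sup>2 = (\<Sum>s = 1..n. real s * x ^ s) - ?T n"
    by simp
  then show ?thesis
    by (simp only: h)
qed

section \<open>General facts on independence and on \<open>[0,1]\<close>-valued variables\<close>

lemma (in prob_space) indep_sets_reindex:
  assumes inj: "inj_on h J" and indep: "indep_sets F (h ` J)"
  shows "indep_sets (\<lambda>j. F (h j)) J"
  unfolding indep_sets_def
proof (intro conjI ballI allI impI)
  show "F (h j) \<subseteq> events" if "j \<in> J" for j
    using indep that by (auto simp: indep_sets_def)
  fix K A
  assume K: "K \<subseteq> J" "K \<noteq> {}" "finite K" and A: "A \<in> Pi K (\<lambda>j. F (h j))"
  have inv: "inv_into K h (h j) = j" if "j \<in> K" for j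
    using inj_on_subset[OF inj K(1)] that by (rule inv_into_f_f)
  have "prob (\<Inter>k\<in>h ` K. A (inv_into K h k)) = (\<Prod>k\<in>h ` K. prob (A (inv_into K h k)))"
    using K A inv by (intro indep_setsD[OF indep]) auto
  then show "prob (\<Inter>j\<in>K. A j) = (\<Prod>j\<in>K. prob (A j))"
    using inv by (simp add: prod.reindex[OF inj_on_subset[OF inj K(1)]])
qed

lemma (in prob_space) indep_vars_reindex:
  assumes "inj_on h J" "indep_vars M' X (h ` J)"
  shows "indep_vars (\<lambda>j. M' (h j)) (\<lambda>j. X (h j)) J"
  using assms indep_sets_reindex[OF assms(1), of "\<lambda>i. {X i -` A \<inter> space M |A. A \<in> sets (M' i)}"]
  unfolding indep_vars_def2 by auto

lemma (in prob_space) indep_event_prob_Int: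
  assumes "indep_event A B"
  shows "prob (A \<inter> B) = prob A * prob B"
proof -
  have "\<forall>J\<subseteq>UNIV. J \<noteq> {} \<longrightarrow> finite J \<longrightarrow>
      prob (\<Inter>b\<in>J. case_bool A B b) = (\<Prod>b\<in>J. prob (case_bool A B b))"
    using assms unfolding indep_event_def indep_events_def by (rule conjunct2)
  from this[rule_format, of UNIV] show ?thesis
    by (simp add: UNIV_bool Int_commute mult.commute)
qed

text \<open>Pointwise \<open>X^2 \<le> X\<close> on \<open>[0,1]\<close>. With equal expectations,
  the nonnegative variable \<open>X - X^2\<close> has integral 0 and so vanishes almost
  everywhere.\<close>

lemma (in prob_space) expectation_square_le_expectation:
  assumes [measurable]: "random_variable borel X"
    and bounds: "\<And>\<omega>. 0 \<le> X \<omega>" "\<And>\<omega>. X \<omega> \<le> (1::real)"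
  shows "expectation (\<lambda>\<omega>. (X \<omega>)\<^sup>2) \<le> expectation X"
    and "expectation (\<lambda>\<omega>. (X \<omega>)\<^sup>2) = expectation X \<Longrightarrow> AE \<omega> in M. X \<omega> \<in> {0, 1}"
proof -
  have sq: "(X \<omega>)\<^sup>2 \<le> X \<omega>" for \<omega>
    using mult_left_le[of "X \<omega>" "X \<omega>"] bounds[of \<omega>] by (simp add: power2_eq_square)
  have int: "integrable M X" "integrable M (\<lambda>\<omega>. (X \<omega>)\<^sup>2)"
    by (auto intro!: integrable_const_bound[where B = 1] simp: bounds abs_square_le_1)
  show "expectation (\<lambda>\<omega>. (X \<omega>)\<^sup>2) \<le> expectation X"
    using int sq by (intro integral_mono) auto
  assume "expectation (\<lambda>\<omega>. (X \<omega>)\<^sup>2) = expectation X"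
  then have "expectation (\<lambda>\<omega>. X \<omega> - (X \<omega>)\<^sup>2) = 0"
    using int by simp
  then have "AE \<omega> in M. X \<omega> - (X \<omega>)\<^sup>2 = 0"
    using int sq by (subst (asm) integral_nonneg_eq_0_iff_AE) auto
  then show "AE \<omega> in M. X \<omega> \<in> {0, 1}"
    by eventually_elim (auto simp: power2_eq_square)
qed

section \<open>Law of the acceptance rates in a round with random start\<close>

context speculative_decoding
begin

lemma accept_rate_measurable:
  assumes "i \<in> {1..num_drafters S}" "l \<ge> prompt_len S"
  shows "random_variable borel (accept_rate S i l)"
  using rates_indep[OF assms(1)] assms(2) by (auto simp: indep_vars_def)

lemma prob_space_rate_law:
  assumes "i \<in> {1..num_drafters S}"
  shows "prob_space (rate_law S i)"
  using prob_space_distr[OF accept_rate_measurable[OF assms order_refl]] rates_law[OF assms order_refl]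
  by simp

lemma distr_rate_block:
  assumes i: "i \<in> {1..num_drafters S}" and l: "l \<ge> prompt_len S"
  shows "distr (outcomes S) (Pi\<^sub>M {..<n_max S} (\<lambda>_. borel)) (rate_block S i l)
    = Pi\<^sub>M {..<n_max S} (\<lambda>_. rate_law S i)"
proof -
  have "indep_vars (\<lambda>_. borel) (accept_rate S i) ((+) l ` {..<n_max S})"
    using l by (intro indep_vars_subset[OF rates_indep[OF i]]) auto
  then have "indep_vars (\<lambda>_. borel) (\<lambda>j. accept_rate S i (l + j)) {..<n_max S}"
    using indep_vars_reindex[of "(+) l" "{..<n_max S}" "\<lambda>_. borel" "accept_rate S i"]
    by (simp add: comp_def)
  then have "distr (outcomes S) (Pi\<^sub>M {..<n_max S} (\<lambda>_. borel)) (\<lambda>\<omega>. \<lambda>j\<in>{..<n_max S}. accept_rate S i (l + j) \<omega>)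
      = Pi\<^sub>M {..<n_max S} (\<lambda>j. distr (outcomes S) borel (accept_rate S i (l + j)))"
    using n_max_pos l
    by (subst (asm) indep_vars_iff_distr_eq_PiM') (auto intro: accept_rate_measurable[OF i] simp: lessThan_empty_iff)
  then show ?thesis
    using l by (simp add: rate_block_def[abs_def] rates_law[OF i])
qed

lemma rate_block_measurable:
  assumes "i \<in> {1..num_drafters S}" "l \<ge> prompt_len S"
  shows "rate_block S i l \<in> measurable (outcomes S) (Pi\<^sub>M {..<n_max S} (\<lambda>_. borel))"
  unfolding rate_block_def[abs_def] using assms
  by (intro measurable_restrict accept_rate_measurable) auto

lemma random_rate_block_measurable:
  assumes i: "i \<in> {1..num_drafters S}"
  shows "(\<lambda>\<omega>. rate_block S i (input_len S t \<omega>) \<omega>) \<in> measurable (outcomes S) (Pi\<^sub>M {..<n_max S} (\<lambda>_. borel))"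
proof -
  \<comment> \<open>Gluing over the countably many starts asks for measurability at every
    \<open>l\<close>, but it is known only from \<open>prompt_len S\<close> on. The maximum repairs
    this and changes nothing on the sample space.\<close>
  have "(\<lambda>\<omega>. rate_block S i (max (prompt_len S) (input_len S t \<omega>)) \<omega>)
      \<in> measurable (outcomes S) (Pi\<^sub>M {..<n_max S} (\<lambda>_. borel))"
  proof (rule measurable_compose_countable[OF _ input_len_measurable])
    show "(\<lambda>\<omega>. rate_block S i (max (prompt_len S) l) \<omega>)
        \<in> measurable (outcomes S) (Pi\<^sub>M {..<n_max S} (\<lambda>_. borel))" for l
      by (intro rate_block_measurable[OF i]) simp
  qed
  then show ?thesis
    by (rule measurable_cong[THEN iffD1, rotated]) (simp add: input_len_ge max_absorb2)
qed

text \<open>Since the start of the round does not anticipate the rates of its block, the block has the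
  product law conditionally on every possible value of the start.\<close>

lemma distr_random_rate_block:
  assumes i: "i \<in> {1..num_drafters S}"
  shows "distr (outcomes S) (Pi\<^sub>M {..<n_max S} (\<lambda>_. borel)) (\<lambda>\<omega>. rate_block S i (input_len S t \<omega>) \<omega>)
    = Pi\<^sub>M {..<n_max S} (\<lambda>_. rate_law S i)"
proof (rule measure_eqI)
  interpret law: prob_space "Pi\<^sub>M {..<n_max S} (\<lambda>_. rate_law S i)"
    by (intro prob_space_PiM prob_space_rate_law i)
  have sets_law: "sets (Pi\<^sub>M {..<n_max S} (\<lambda>_. rate_law S i)) = sets (Pi\<^sub>M {..<n_max S} (\<lambda>_. borel))"
    by (intro sets_PiM_cong refl) (metis i order_refl rates_law sets_distr)
  then show "sets (distr (outcomes S) (Pi\<^sub>M {..<n_max S} (\<lambda>_. borel)) (\<lambda>\<omega>. rate_block S i (input_len S t \<omega>) \<omega>))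
      = sets (Pi\<^sub>M {..<n_max S} (\<lambda>_. rate_law S i))"
    by simp
  fix B
  assume "B \<in> sets (distr (outcomes S) (Pi\<^sub>M {..<n_max S} (\<lambda>_. borel)) (\<lambda>\<omega>. rate_block S i (input_len S t \<omega>) \<omega>))"
  then have B: "B \<in> sets (Pi\<^sub>M {..<n_max S} (\<lambda>_. borel))"
    by simp
  \<comment> \<open>The events \<open>L l\<close> partition the sample space by the start of the
    round, and \<open>A l\<close> is the part of \<open>L l\<close> where the block lies in
    \<open>B\<close>. On each part the block at the random start is the block at the fixed start
    \<open>l\<close>.\<close>
  define L where "L l = {\<omega> \<in> space (outcomes S). input_len S t \<omega> = l}" for l
  define A where "A l = L l \<inter> {\<omega> \<in> space (outcomes S). rate_block S i l \<omega> \<in> B}" for l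
  have L_events: "L l \<in> events" for l
    using measurable_sets[OF input_len_measurable, of "{l}" t] by (simp add: L_def vimage_def Int_def conj_commute)
  have L_empty: "L l = {}" if "l < prompt_len S" for l
    using that input_len_ge[of _ t] by (fastforce simp: L_def)
  have block_event: "{\<omega> \<in> space (outcomes S). rate_block S i l \<omega> \<in> B} \<in> events" if "l \<ge> prompt_len S" for l
    using measurable_sets[OF rate_block_measurable[OF i that] B] by (simp add: vimage_def Int_def conj_commute)
  have A_events: "A l \<in> events" for l
    using L_empty[of l] L_events block_event[of l] by (cases "l < prompt_len S") (auto simp: A_def)
  have prob_A: "prob (A l) = prob (L l) * law.prob B" for l
  proof (cases "l < prompt_len S")
    case False
    then have l: "l \<ge> prompt_len S" by simp
    have "prob {\<omega> \<in> space (outcomes S). rate_block S i l \<omega> \<in> B} = law.prob B"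
      unfolding distr_rate_block[OF i l, symmetric]
      using measure_distr[OF rate_block_measurable[OF i l] B]
      by (simp add: vimage_def Int_def conj_commute)
    then show ?thesis
      using indep_event_prob_Int[OF input_len_nonanticipating[OF i l B, of t]] by (simp add: A_def L_def)
  qed (simp add: A_def L_empty)
  have disj: "disjoint_family L" "disjoint_family A"
    by (auto simp: disjoint_family_on_def L_def A_def)
  have "(\<lambda>l. prob (L l)) sums prob (\<Union>l. L l)"
    using L_events by (intro finite_measure_UNION disj) auto
  moreover have "(\<Union>l. L l) = space (outcomes S)"
    by (auto simp: L_def)
  ultimately have "(\<lambda>l. prob (L l)) sums 1"
    by (simp add: prob_space)
  then have "(\<lambda>l. prob (A l)) sums law.prob B"
    unfolding prob_A using sums_mult2[of "\<lambda>l. prob (L l)" 1 "law.prob B"] by simp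
  moreover have "(\<lambda>l. prob (A l)) sums prob (\<Union>l. A l)"
    using A_events by (intro finite_measure_UNION disj) auto
  moreover have "(\<Union>l. A l) = (\<lambda>\<omega>. rate_block S i (input_len S t \<omega>) \<omega>) -` B \<inter> space (outcomes S)"
    by (auto simp: A_def L_def)
  ultimately show "emeasure (distr (outcomes S) (Pi\<^sub>M {..<n_max S} (\<lambda>_. borel)) (\<lambda>\<omega>. rate_block S i (input_len S t \<omega>) \<omega>)) B
      = emeasure (Pi\<^sub>M {..<n_max S} (\<lambda>_. rate_law S i)) B"
    by (simp add: emeasure_distr[OF random_rate_block_measurable[OF i] B] emeasure_eq_measure law.emeasure_eq_measure sums_unique2)
qed

text \<open>A coordinate of the block at the random start, without the value
  \<open>undefined\<close> that \<open>rate_block\<close> takes outside \<open>{..<n_max S}\<close>;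
  the bounds thus hold for every \<open>j\<close>.\<close>

definition round_rate :: "nat \<Rightarrow> nat \<Rightarrow> nat \<Rightarrow> 'w \<Rightarrow> real" where
  "round_rate i t j \<omega> = accept_rate S i (input_len S t \<omega> + j) \<omega>"

lemma round_rate_bounds: "0 \<le> round_rate i t j \<omega>" "round_rate i t j \<omega> \<le> 1"
  by (simp_all add: round_rate_def accept_rate_bounds)

lemma round_rate_measurable:
  assumes "i \<in> {1..num_drafters S}" "j < n_max S"
  shows "random_variable borel (round_rate i t j)"
proof -
  have "(\<lambda>\<omega>. rate_block S i (input_len S t \<omega>) \<omega> j) \<in> borel_measurable (outcomes S)"
    using assms measurable_compose[OF random_rate_block_measurable[OF assms(1)] measurable_component_singleton[of j]]
    by simp
  then show ?thesis
    using assms(2) by (simp add: rate_block_def round_rate_def[abs_def])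
qed

text \<open>The block at the random start has a product law: its marginals give the first claim, and
  equality of the joint law with the product of the marginals is independence.\<close>

lemma
  assumes i: "i \<in> {1..num_drafters S}"
  shows distr_round_rate: "j < n_max S \<Longrightarrow> distr (outcomes S) borel (round_rate i t j) = rate_law S i"
    and round_rate_indep: "indep_vars (\<lambda>_. borel) (round_rate i t) {..<n_max S}"
proof -
  have block: "(\<lambda>\<omega>. rate_block S i (input_len S t \<omega>) \<omega>) = (\<lambda>\<omega>. \<lambda>j\<in>{..<n_max S}. round_rate i t j \<omega>)"
    by (simp add: rate_block_def round_rate_def[abs_def])
  show law: "distr (outcomes S) borel (round_rate i t j) = rate_law S i" if j: "j < n_max S" for j
  proof -
    have "distr (outcomes S) borel (round_rate i t j)
        = distr (outcomes S) borel ((\<lambda>x. x j) \<circ> (\<lambda>\<omega>. rate_block S i (input_len S t \<omega>) \<omega>))"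
      using j by (intro distr_cong) (auto simp: rate_block_def round_rate_def)
    also have "\<dots> = distr (Pi\<^sub>M {..<n_max S} (\<lambda>_. rate_law S i)) borel (\<lambda>x. x j)"
      using j by (simp flip: distr_random_rate_block[OF i, of t] add: distr_distr random_rate_block_measurable[OF i])
    \<comment> \<open>The target \<open>borel\<close> is exchanged for \<open>rate_law S i\<close>,
      which has the same measurable sets, to fit the projection rule for product measures.\<close>
    also have "\<dots> = distr (Pi\<^sub>M {..<n_max S} (\<lambda>_. rate_law S i)) (rate_law S i) (\<lambda>x. x j)"
      by (intro distr_cong refl) (metis i order_refl rates_law sets_distr)
    also have "\<dots> = rate_law S i"
      using j by (intro distr_PiM_component prob_space_rate_law i) auto
    finally show ?thesis .
  qed
  show "indep_vars (\<lambda>_. borel) (round_rate i t) {..<n_max S}"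
  proof (subst indep_vars_iff_distr_eq_PiM')
    show "{..<n_max S} \<noteq> {}"
      using n_max_pos by (simp add: lessThan_empty_iff)
    have "Pi\<^sub>M {..<n_max S} (\<lambda>j. distr (outcomes S) borel (round_rate i t j)) = Pi\<^sub>M {..<n_max S} (\<lambda>_. rate_law S i)"
      by (intro PiM_cong refl law) simp
    then show "distr (outcomes S) (Pi\<^sub>M {..<n_max S} (\<lambda>_. borel)) (\<lambda>\<omega>. \<lambda>j\<in>{..<n_max S}. round_rate i t j \<omega>)
        = Pi\<^sub>M {..<n_max S} (\<lambda>j. distr (outcomes S) borel (round_rate i t j))"
      using distr_random_rate_block[OF i, of t] by (simp only: block)
  qed (simp add: round_rate_measurable[OF i])
qed

section \<open>Moments of the rates and of the block divergence\<close>

lemma expectation_round_rate: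
  assumes "i \<in> {1..num_drafters S}" "j < n_max S"
  shows "expectation (round_rate i t j) = mean_rate S i"
proof -
  have "(\<integral>a. a \<partial>distr (outcomes S) borel (round_rate i t j)) = expectation (round_rate i t j)"
    by (intro integral_distr round_rate_measurable assms) simp
  then show ?thesis
    by (simp only: distr_round_rate[OF assms] mean_rate_def)
qed

lemma expectation_prod_round_rate:
  assumes i: "i \<in> {1..num_drafters S}" and J: "J \<subseteq> {..<n_max S}"
  shows "expectation (\<lambda>\<omega>. \<Prod>j\<in>J. round_rate i t j \<omega>) = mean_rate S i ^ card J"
proof -
  have "finite J"
    by (rule finite_subset[OF J]) simp
  then have "expectation (\<lambda>\<omega>. \<Prod>j\<in>J. round_rate i t j \<omega>) = (\<Prod>j\<in>J. expectation (round_rate i t j))"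
    using J round_rate_bounds
    by (intro indep_vars_lebesgue_integral indep_vars_subset[OF round_rate_indep[OF i] J]
         integrable_const_bound[where B = 1] round_rate_measurable[OF i]) auto
  also have "\<dots> = (\<Prod>j\<in>J. mean_rate S i)"
    using J by (intro prod.cong expectation_round_rate i) auto
  finally show ?thesis
    by simp
qed

text \<open>The equality case is moved from the sample space to \<open>rate_law S i\<close>, where
  it no longer depends on the round or the position.\<close>

lemma round_rate_square_le:
  assumes i: "i \<in> {1..num_drafters S}" and j: "j < n_max S"
  shows "expectation (\<lambda>\<omega>. (round_rate i t j \<omega>)\<^sup>2) \<le> mean_rate S i"
    and "expectation (\<lambda>\<omega>. (round_rate i t j \<omega>)\<^sup>2) = mean_rate S i \<Longrightarrow> AE a in rate_law S i. a \<in> {0, 1}"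
proof -
  note X = round_rate_measurable[OF i j, of t]
  show "expectation (\<lambda>\<omega>. (round_rate i t j \<omega>)\<^sup>2) \<le> mean_rate S i"
    using expectation_square_le_expectation(1)[OF X] round_rate_bounds expectation_round_rate[OF i j]
    by simp
  assume "expectation (\<lambda>\<omega>. (round_rate i t j \<omega>)\<^sup>2) = mean_rate S i"
  then have "AE \<omega> in outcomes S. round_rate i t j \<omega> \<in> {0, 1}"
    using expectation_square_le_expectation(2)[OF X] round_rate_bounds expectation_round_rate[OF i j]
    by simp
  moreover have "(AE a in distr (outcomes S) borel (round_rate i t j). a \<in> {0, 1})
      \<longleftrightarrow> (AE \<omega> in outcomes S. round_rate i t j \<omega> \<in> {0, 1})"
    by (intro AE_distr_iff X) auto
  ultimately show "AE a in rate_law S i. a \<in> {0, 1}"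
    by (simp only: distr_round_rate[OF i j])
qed

definition rate_variance :: "nat \<Rightarrow> real" where
  "rate_variance i = (\<integral>a. a\<^sup>2 \<partial>rate_law S i) - (mean_rate S i)\<^sup>2"

lemma expectation_round_rate_square:
  assumes i: "i \<in> {1..num_drafters S}" and j: "j < n_max S"
  shows "expectation (\<lambda>\<omega>. (round_rate i t j \<omega>)\<^sup>2) = rate_variance i + (mean_rate S i)\<^sup>2"
  using integral_distr[OF round_rate_measurable[OF i j], of "\<lambda>x. x\<^sup>2" t] distr_round_rate[OF i j]
  by (simp add: rate_variance_def)

text \<open>A law on \<open>[0,1]\<close> has second moment at most its mean, so the Bernoulli law
  has the largest variance for a given mean; the maximum forces values in
  \<open>{0, 1}\<close>.\<close>

lemma rate_variance_le:
  assumes i: "i \<in> {1..num_drafters S}"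
  shows "rate_variance i \<le> mean_rate S i * (1 - mean_rate S i)"
    and "rate_variance i = mean_rate S i * (1 - mean_rate S i) \<Longrightarrow> AE a in rate_law S i. a \<in> {0, 1}"
proof -
  have j: "0 < n_max S"
    using n_max_pos by simp
  have eq: "mean_rate S i * (1 - mean_rate S i) = mean_rate S i - (mean_rate S i)\<^sup>2"
    by (simp add: power2_eq_square right_diff_distrib)
  show "rate_variance i \<le> mean_rate S i * (1 - mean_rate S i)"
    using round_rate_square_le(1)[OF i j, of t] expectation_round_rate_square[OF i j, of t] eq by simp
  show "AE a in rate_law S i. a \<in> {0, 1}" if "rate_variance i = mean_rate S i * (1 - mean_rate S i)"
    using round_rate_square_le(2)[OF i j, of t] expectation_round_rate_square[OF i j, of t] eq that by simp
qed

lemma block_divergence_eq_round_rate: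
  "block_divergence S i t = (\<lambda>\<omega>. (\<Sum>j<n_max S. round_rate i t j \<omega>) / real (n_max S))"
  by (simp add: block_divergence_def[abs_def] round_rate_def accept_rate_def atLeast0LessThan)

text \<open>The squared sum is expanded into pairs \<open>j, k\<close>. By independence every pair
  contributes the squared mean, and the \<open>n_max S\<close> diagonal pairs add
  \<open>rate_variance i\<close> each.\<close>

lemma
  assumes i: "i \<in> {1..num_drafters S}"
  shows expectation_block_divergence: "expectation (block_divergence S i t) = mean_rate S i"
    and variance_block_divergence: "variance (block_divergence S i t) = rate_variance i / real (n_max S)"
proof -
  let ?n = "n_max S" and ?X = "round_rate i t"
  have n: "0 < real ?n"
    using n_max_pos by simp
  note [measurable] = round_rate_measurable[OF i]
  have int: "integrable (outcomes S) (?X j)" "k < ?n \<Longrightarrow> integrable (outcomes S) (\<lambda>\<omega>. ?X j \<omega> * ?X k \<omega>)"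
    if "j < ?n" for j k
    using that by (auto intro!: integrable_const_bound[where B = 1] AE_I2 mult_le_one simp: round_rate_bounds abs_mult)
  have E: "expectation (?X j) = mean_rate S i" if "j < ?n" for j
    by (rule expectation_round_rate[OF i that])
  show mean: "expectation (block_divergence S i t) = mean_rate S i"
    using n int(1) by (simp add: block_divergence_eq_round_rate E)
  have EE: "expectation (\<lambda>\<omega>. ?X j \<omega> * ?X k \<omega>) = (mean_rate S i)\<^sup>2 + (if j = k then rate_variance i else 0)"
    if "j < ?n" "k < ?n" for j k
  proof (cases "j = k")
    case True
    then show ?thesis
      using expectation_round_rate_square[OF i that(1), of t] by (simp add: power2_eq_square)
  next
    case False
    then show ?thesis
      using expectation_prod_round_rate[OF i, of "{j, k}" t] that by (simp add: power2_eq_square)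
  qed
  have sq: "(block_divergence S i t \<omega>)\<^sup>2 = (\<Sum>j<?n. \<Sum>k<?n. ?X j \<omega> * ?X k \<omega>) / (real ?n)\<^sup>2" for \<omega>
    by (simp add: block_divergence_eq_round_rate power_divide power2_eq_square sum_product)
  have "expectation (\<lambda>\<omega>. (block_divergence S i t \<omega>)\<^sup>2)
      = (\<Sum>j<?n. \<Sum>k<?n. expectation (\<lambda>\<omega>. ?X j \<omega> * ?X k \<omega>)) / (real ?n)\<^sup>2"
  proof -
    have "expectation (\<lambda>\<omega>. \<Sum>j<?n. \<Sum>k<?n. ?X j \<omega> * ?X k \<omega>)
        = (\<Sum>j<?n. expectation (\<lambda>\<omega>. \<Sum>k<?n. ?X j \<omega> * ?X k \<omega>))"
      by (intro Bochner_Integration.integral_sum Bochner_Integration.integrable_sum int(2)) auto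
    also have "\<dots> = (\<Sum>j<?n. \<Sum>k<?n. expectation (\<lambda>\<omega>. ?X j \<omega> * ?X k \<omega>))"
      by (intro sum.cong refl Bochner_Integration.integral_sum int(2)) auto
    finally show ?thesis
      unfolding sq by simp
  qed
  also have "(\<Sum>j<?n. \<Sum>k<?n. expectation (\<lambda>\<omega>. ?X j \<omega> * ?X k \<omega>))
      = (\<Sum>j<?n. \<Sum>k<?n. (mean_rate S i)\<^sup>2 + (if j = k then rate_variance i else 0))"
    by (intro sum.cong refl EE) auto
  also have "\<dots> = (real ?n)\<^sup>2 * (mean_rate S i)\<^sup>2 + real ?n * rate_variance i"
    by (simp add: sum.distrib power2_eq_square distrib_left)
  finally have "expectation (\<lambda>\<omega>. (block_divergence S i t \<omega>)\<^sup>2) = (mean_rate S i)\<^sup>2 + rate_variance i / real ?n"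
    using n by (simp add: add_divide_distrib power2_eq_square)
  moreover have "integrable (outcomes S) (block_divergence S i t)"
    "integrable (outcomes S) (\<lambda>\<omega>. (block_divergence S i t \<omega>)\<^sup>2)"
    unfolding sq unfolding block_divergence_eq_round_rate
    by (auto intro!: integrable_divide_zero Bochner_Integration.integrable_sum int)
  ultimately show "variance (block_divergence S i t) = rate_variance i / real ?n"
    by (subst variance_eq) (simp_all add: mean)
qed

section \<open>Verification of the candidates and moments of the block efficiency\<close>

lemma verification_info_map_measurable:
  assumes i: "i \<in> {1..num_drafters S}"
  shows "(\<lambda>\<omega>. (rate_block S i (input_len S t \<omega>) \<omega>, j \<le> n_acc S i t \<omega>))
    \<in> measurable (outcomes S) (Pi\<^sub>M {..<n_max S} (\<lambda>_. borel) \<Otimes>\<^sub>M count_space UNIV)"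
  using n_acc_measurable[OF i, of t] random_rate_block_measurable[OF i, of t]
  by (intro measurable_Pair) (auto intro: measurable_compose)

lemma verification_info_subalgebra:
  assumes i: "i \<in> {1..num_drafters S}"
  shows "subalgebra (outcomes S) (verification_info S i t j)"
  unfolding subalgebra_def verification_info_def
  by (auto intro: sets_image_in_sets[OF refl verification_info_map_measurable[OF i], THEN subsetD])

lemma verification_info_measurable:
  assumes i: "i \<in> {1..num_drafters S}"
  shows "(\<lambda>\<omega>. rate_block S i (input_len S t \<omega>) \<omega>) \<in> measurable (verification_info S i t j) (Pi\<^sub>M {..<n_max S} (\<lambda>_. borel))"
    and "(\<lambda>\<omega>. j \<le> n_acc S i t \<omega>) \<in> measurable (verification_info S i t j) (count_space UNIV)"
proof -
  have "(\<lambda>\<omega>. (rate_block S i (input_len S t \<omega>) \<omega>, j \<le> n_acc S i t \<omega>))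
      \<in> measurable (verification_info S i t j) (Pi\<^sub>M {..<n_max S} (\<lambda>_. borel) \<Otimes>\<^sub>M count_space UNIV)"
    unfolding verification_info_def
    by (intro measurable_vimage_algebra1 funcsetI measurable_space[OF verification_info_map_measurable[OF i]])
  from measurable_compose[OF this measurable_fst] measurable_compose[OF this measurable_snd]
  show "(\<lambda>\<omega>. rate_block S i (input_len S t \<omega>) \<omega>) \<in> measurable (verification_info S i t j) (Pi\<^sub>M {..<n_max S} (\<lambda>_. borel))"
    and "(\<lambda>\<omega>. j \<le> n_acc S i t \<omega>) \<in> measurable (verification_info S i t j) (count_space UNIV)"
    by simp_all
qed

text \<open>Weighting by the rates at later positions makes the induction over the candidates go through.\<close>

lemma expectation_reached_prod:
  assumes i: "i \<in> {1..num_drafters S}"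
  shows "j \<le> n_max S \<Longrightarrow> J \<subseteq> {j..<n_max S} \<Longrightarrow>
    expectation (\<lambda>\<omega>. of_bool (j \<le> n_acc S i t \<omega>) * (\<Prod>k\<in>J. round_rate i t k \<omega>))
      = mean_rate S i ^ (j + card J)"
proof (induction j arbitrary: J)
  case 0
  then show ?case
    using expectation_prod_round_rate[OF i, of J t] by (simp add: atLeast0LessThan)
next
  case (Suc j)
  let ?F = "verification_info S i t j" and ?N = "n_acc S i t" and ?P = "\<lambda>\<omega>. \<Prod>k\<in>J. round_rate i t k \<omega>"
  let ?A = "{\<omega> \<in> space (outcomes S). j < ?N \<omega>}"
  let ?f = "\<lambda>\<omega>. of_bool (j \<le> ?N \<omega>) * ?P \<omega>"
  interpret finite_measure_subalgebra "outcomes S" ?F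
    by unfold_locales (rule verification_info_subalgebra[OF i])
  have finite: "finite J"
    using Suc.prems(2) finite_subset by blast
  have A: "?A \<in> events"
    using measurable_sets[OF n_acc_measurable[OF i], of "{j<..}" t] by (simp add: vimage_def Int_def conj_commute)
  have "(\<lambda>\<omega>. round_rate i t k \<omega>) \<in> borel_measurable ?F" if "k \<in> J" for k
  proof -
    have k: "k < n_max S"
      using that Suc.prems(2) by auto
    then have "(\<lambda>\<omega>. rate_block S i (input_len S t \<omega>) \<omega> k) \<in> borel_measurable ?F"
      by (intro measurable_compose[OF verification_info_measurable(1)[OF i] measurable_component_singleton]) auto
    then show ?thesis
      using k by (simp add: rate_block_def round_rate_def[abs_def])
  qed
  \<comment> \<open>The weight depends only on the rates of the block and on
    \<open>j \<le> ?N\<close>, hence is known at verification and can be paired with the conditional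
    expectation.\<close>
  then have f: "?f \<in> borel_measurable ?F"
    using measurable_compose[OF verification_info_measurable(2)[OF i, of j t], of of_bool borel]
    by (intro borel_measurable_times borel_measurable_prod) auto
  have f_bound: "norm (?f \<omega>) \<le> 1" for \<omega>
    using round_rate_bounds by (auto simp: abs_prod intro!: prod_le_1)
  have f_M: "?f \<in> borel_measurable (outcomes S)"
    by (rule measurable_from_subalg[OF subalg f])
  have int: "integrable (outcomes S) (\<lambda>\<omega>. ?f \<omega> * indicator ?A \<omega>)"
    using f_M A f_bound
    by (intro integrable_real_mult_indicator integrable_const_bound[where B = 1 and f = ?f] AE_I2)
  have "expectation (\<lambda>\<omega>. of_bool (Suc j \<le> ?N \<omega>) * ?P \<omega>) = expectation (\<lambda>\<omega>. ?f \<omega> * indicator ?A \<omega>)"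
    by (intro Bochner_Integration.integral_cong) (auto simp: indicator_def)
  also have "\<dots> = expectation (\<lambda>\<omega>. ?f \<omega> * real_cond_exp (outcomes S) ?F (indicator ?A) \<omega>)"
    using A by (intro real_cond_exp_intg(2)[symmetric] int f) auto
  \<comment> \<open>\<open>verification\<close> fixes the conditional expectation only where
    \<open>j \<le> ?N\<close>; elsewhere the factor \<open>of_bool\<close> is 0. The acceptance of
    candidate \<open>j\<close> thus turns into its rate, which joins the product.\<close>
  also have "\<dots> = expectation (\<lambda>\<omega>. of_bool (j \<le> ?N \<omega>) * (\<Prod>k\<in>insert j J. round_rate i t k \<omega>))"
  proof (rule integral_cong_AE)
    have "j \<notin> J"
      using Suc.prems(2) by auto
    moreover have "AE \<omega> in outcomes S. j \<le> ?N \<omega> \<longrightarrow>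
        real_cond_exp (outcomes S) ?F (indicator ?A) \<omega> = round_rate i t j \<omega>"
      using verification[OF i, of j t] Suc.prems(1) by (simp add: round_rate_def)
    ultimately show "AE \<omega> in outcomes S. ?f \<omega> * real_cond_exp (outcomes S) ?F (indicator ?A) \<omega>
        = of_bool (j \<le> ?N \<omega>) * (\<Prod>k\<in>insert j J. round_rate i t k \<omega>)"
      using finite by (auto simp: mult_ac)
    show "(\<lambda>\<omega>. ?f \<omega> * real_cond_exp (outcomes S) ?F (indicator ?A) \<omega>) \<in> borel_measurable (outcomes S)"
      by (intro borel_measurable_times f_M) auto
    show "(\<lambda>\<omega>. of_bool (j \<le> ?N \<omega>) * (\<Prod>k\<in>insert j J. round_rate i t k \<omega>)) \<in> borel_measurable (outcomes S)"
      using measurable_compose[OF n_acc_measurable[OF i, of t], of "\<lambda>m. of_bool (j \<le> m) :: real" borel] Suc.prems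
      by (intro borel_measurable_times borel_measurable_prod round_rate_measurable[OF i]) auto
  qed
  also have "\<dots> = mean_rate S i ^ (j + card (insert j J))"
    using Suc.prems by (intro Suc.IH) auto
  also have "card (insert j J) = Suc (card J)"
    using Suc.prems(2) finite by (intro card_insert_disjoint) auto
  finally show ?case
    by simp
qed

text \<open>Layer summation: a sum of \<open>c s\<close> over \<open>s \<le> n_acc\<close> has
  expectation \<open>\<Sum> c s * \<alpha> ^ s\<close>. The weights \<open>c s = 1\<close> give the
  mean and \<open>c s = 2 * s - 1\<close> the second moment.\<close>

lemma
  assumes i: "i \<in> {1..num_drafters S}"
  shows expectation_n_acc: "expectation (\<lambda>\<omega>. real (n_acc S i t \<omega>)) = (\<Sum>s = 1..n_max S. mean_rate S i ^ s)"
    and variance_n_acc: "variance (\<lambda>\<omega>. real (n_acc S i t \<omega>)) = mean_rate S i * h_n (n_max S) (mean_rate S i)"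
proof -
  let ?N = "n_acc S i t" and ?n = "n_max S" and ?\<alpha> = "mean_rate S i"
  have E: "expectation (\<lambda>\<omega>. of_bool (s \<le> ?N \<omega>)) = ?\<alpha> ^ s" if "s \<in> {1..?n}" for s
    using expectation_reached_prod[OF i, of s "{}" t] that by simp
  have int: "integrable (outcomes S) (\<lambda>\<omega>. of_bool (s \<le> ?N \<omega>) :: real)" for s
    using measurable_compose[OF n_acc_measurable[OF i, of t], of "\<lambda>m. of_bool (s \<le> m) :: real" borel]
    by (intro integrable_const_bound[where B = 1]) auto
  have layers: "(\<Sum>s = 1..?n. c s * of_bool (s \<le> ?N \<omega>)) = (\<Sum>s = 1..?N \<omega>. c s)"
    if "\<omega> \<in> space (outcomes S)" for \<omega> and c :: "nat \<Rightarrow> real"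
    using n_acc_le[OF i that, of t]
    by (intro sum.mono_neutral_cong_right) auto
  have expectation_layers: "expectation (\<lambda>\<omega>. \<Sum>s = 1..?N \<omega>. c s) = (\<Sum>s = 1..?n. c s * ?\<alpha> ^ s)"
    and integrable_layers: "integrable (outcomes S) (\<lambda>\<omega>. \<Sum>s = 1..?N \<omega>. c s)" for c :: "nat \<Rightarrow> real"
  proof -
    have "expectation (\<lambda>\<omega>. \<Sum>s = 1..?N \<omega>. c s) = expectation (\<lambda>\<omega>. \<Sum>s = 1..?n. c s * of_bool (s \<le> ?N \<omega>))"
      by (intro Bochner_Integration.integral_cong) (simp_all only: layers)
    also have "\<dots> = (\<Sum>s = 1..?n. expectation (\<lambda>\<omega>. c s * of_bool (s \<le> ?N \<omega>)))"
      by (intro Bochner_Integration.integral_sum integrable_mult_right int)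
    also have "\<dots> = (\<Sum>s = 1..?n. c s * ?\<alpha> ^ s)"
      by (intro sum.cong refl) (simp only: integral_mult_right_zero E)
    finally show "expectation (\<lambda>\<omega>. \<Sum>s = 1..?N \<omega>. c s) = (\<Sum>s = 1..?n. c s * ?\<alpha> ^ s)" .
    have "integrable (outcomes S) (\<lambda>\<omega>. \<Sum>s = 1..?n. c s * of_bool (s \<le> ?N \<omega>))"
      by (intro Bochner_Integration.integrable_sum integrable_mult_right int)
    then show "integrable (outcomes S) (\<lambda>\<omega>. \<Sum>s = 1..?N \<omega>. c s)"
      by (rule Bochner_Integration.integrable_cong[THEN iffD1, OF refl, rotated]) (rule layers)
  qed
  have square: "(real m)\<^sup>2 = (\<Sum>s = 1..m. 2 * real s - 1)" for m
    by (induction m) (simp_all add: power2_eq_square algebra_simps)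
  show mean: "expectation (\<lambda>\<omega>. real (?N \<omega>)) = (\<Sum>s = 1..?n. ?\<alpha> ^ s)"
    using expectation_layers[of "\<lambda>_. 1"] by simp
  show "variance (\<lambda>\<omega>. real (?N \<omega>)) = ?\<alpha> * h_n ?n ?\<alpha>"
    using expectation_layers[of "\<lambda>s. 2 * real s - 1"] integrable_layers[of "\<lambda>s. 2 * real s - 1"]
      integrable_layers[of "\<lambda>_. 1"]
      second_moment_minus_square_eq_h_n[where n = ?n and x = ?\<alpha>]
    by (subst variance_eq) (simp_all add: mean square)
qed

lemma
  assumes i: "i \<in> {1..num_drafters S}"
  shows expectation_block_efficiency:
      "expectation (block_efficiency S i t) = (\<Sum>s = 1..n_max S. mean_rate S i ^ s) / real (n_max S)"
    and variance_block_efficiency: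
      "variance (block_efficiency S i t) = mean_rate S i * h_n (n_max S) (mean_rate S i) / (real (n_max S))\<^sup>2"
proof -
  show mean: "expectation (block_efficiency S i t) = (\<Sum>s = 1..n_max S. mean_rate S i ^ s) / real (n_max S)"
    by (simp add: block_efficiency_def[abs_def] expectation_n_acc[OF i])
  show "variance (block_efficiency S i t) = mean_rate S i * h_n (n_max S) (mean_rate S i) / (real (n_max S))\<^sup>2"
  proof -
    let ?m = "\<Sum>s = 1..n_max S. mean_rate S i ^ s"
    have "(block_efficiency S i t \<omega> - ?m / real (n_max S))\<^sup>2
        = (real (n_acc S i t \<omega>) - ?m)\<^sup>2 / (real (n_max S))\<^sup>2" for \<omega>
      by (simp only: block_efficiency_def power_divide flip: diff_divide_distrib)
    then show ?thesis
      unfolding mean using variance_n_acc[OF i, of t] by (simp only: expectation_n_acc[OF i] integral_divide_zero)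
  qed
qed

end

text \<open>Since \<open>0 < d\<close>, the quotient is \<open>\<infinity>\<close> if \<open>m = 0\<close>.\<close>

lemma
  assumes "0 < d" "0 \<le> m"
  shows le_ereal_divide: "x * m \<le> d \<Longrightarrow> ereal x \<le> ereal d / ereal m"
    and less_ereal_divide: "x * m < d \<Longrightarrow> ereal x < ereal d / ereal m"
  using assms by (auto simp: ereal_divide pos_le_divide_eq pos_less_divide_eq)

section \<open>Comparison of the two feedback signals\<close>

theorem theorem3:
  fixes S :: "('w, 'v) spec_decoding" and istar i t :: nat
  assumes model: "speculative_decoding S"
    and optimal: "is_arg_max (mean_rate S) (\<lambda>k. k \<in> {1..num_drafters S}) istar"
    and drafter: "i \<in> {1..num_drafters S}"
    and suboptimal: "mean_rate S i < mean_rate S istar"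
  shows "feedback_signal (outcomes S) (\<lambda>k. block_divergence S k t) istar i
           \<ge> ereal (4 * (mean_rate S istar - mean_rate S i)\<^sup>2 * real (n_max S))
    \<and> (h_n (n_max S) (mean_rate S istar)
           \<ge> (g_n (n_max S) (mean_rate S istar))\<^sup>2 / (4 * real (n_max S) * mean_rate S istar)
         \<and> prob_space.variance (outcomes S) (block_efficiency S i t)
           < prob_space.variance (outcomes S) (block_efficiency S istar t)
       \<longrightarrow> feedback_signal (outcomes S) (\<lambda>k. block_divergence S k t) istar i
             \<ge> feedback_signal (outcomes S) (\<lambda>k. block_efficiency S k t) istar i
         \<and> (\<not> (n_max S = 1 \<and> (AE a in rate_law S istar. a \<in> {0, 1}))
            \<longrightarrow> feedback_signal (outcomes S) (\<lambda>k. block_divergence S k t) istar i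
                > feedback_signal (outcomes S) (\<lambda>k. block_efficiency S k t) istar i))"
proof -
  interpret speculative_decoding S
    by (rule model)
  have istar: "istar \<in> {1..num_drafters S}"
    using optimal by (simp add: is_arg_max_def)
  let ?n = "n_max S"
  define a b where "a = mean_rate S i" and "b = mean_rate S istar"
  define v where "v = max (variance (block_divergence S i t)) (variance (block_divergence S istar t))"
  \<comment> \<open>The real value of the block-efficiency signal: the factors
    \<open>1 / n^2\<close> of the squared gap and of the variance cancel.\<close>
  define x where "x = ((\<Sum>s = 1..?n. b ^ s) - (\<Sum>s = 1..?n. a ^ s))\<^sup>2 / (b * h_n ?n b)"
  have n: "1 \<le> real ?n"
    using n_max_pos by simp
  have a: "0 \<le> a"
    using expectation_round_rate[OF drafter, of 0 t] n_max_pos round_rate_bounds(1)[of i t 0]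
    unfolding a_def by (metis Bochner_Integration.integral_nonneg less_le_trans zero_less_one)
  have ab: "a < b"
    using suboptimal by (simp add: a_def b_def)
  then have gap: "0 < (b - a)\<^sup>2"
    by simp
  have quarter: "y * (1 - y) \<le> 1 / 4" for y :: real
    using zero_le_power2[of "y - 1 / 2"] by (simp add: power2_eq_square algebra_simps)
  have "variance (block_divergence S k t) \<le> 1 / (4 * real ?n)" if "k \<in> {1..num_drafters S}" for k
  proof -
    have "rate_variance k \<le> 1 / 4"
      using rate_variance_le(1)[OF that] quarter by (rule order_trans)
    then have "rate_variance k / real ?n \<le> 1 / 4 / real ?n"
      using n by (intro divide_right_mono) auto
    then show ?thesis
      by (simp add: variance_block_divergence[OF that])
  qed
  then have "v \<le> 1 / (4 * real ?n)"
    unfolding v_def using drafter istar by (intro max.boundedI)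
  \<comment> \<open>Stated as a product because \<open>v\<close> may be 0, in which case the signal
    is infinite.\<close>
  then have v_le: "4 * real ?n * v \<le> 1"
    using n by (simp add: field_simps)
  have v: "0 \<le> v"
    unfolding v_def using variance_positive by (simp add: le_max_iff_disj)
  have BD: "feedback_signal (outcomes S) (\<lambda>k. block_divergence S k t) istar i = ereal ((b - a)\<^sup>2) / ereal v"
    by (simp only: feedback_signal_def v_def a_def b_def expectation_block_divergence drafter istar)
  have "4 * (b - a)\<^sup>2 * real ?n * v \<le> (b - a)\<^sup>2"
    using mult_left_mono[OF v_le, of "(b - a)\<^sup>2"] by (simp add: mult_ac)
  then have first: "ereal (4 * (b - a)\<^sup>2 * real ?n) \<le> ereal ((b - a)\<^sup>2) / ereal v"
    by (intro le_ereal_divide gap v)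
  have second: "feedback_signal (outcomes S) (\<lambda>k. block_efficiency S k t) istar i \<le> ereal ((b - a)\<^sup>2) / ereal v
      \<and> (\<not> (?n = 1 \<and> (AE y in rate_law S istar. y \<in> {0, 1})) \<longrightarrow>
        feedback_signal (outcomes S) (\<lambda>k. block_efficiency S k t) istar i < ereal ((b - a)\<^sup>2) / ereal v)"
    if h: "(g_n ?n b)\<^sup>2 / (4 * real ?n * b) \<le> h_n ?n b"
      and var: "variance (block_efficiency S i t) < variance (block_efficiency S istar t)"
  proof -
    have b: "0 < b"
      using a ab by simp
    \<comment> \<open>The strict comparison of the variances makes the denominator of the
      block-efficiency signal positive, so this signal is finite.\<close>
    have "0 < variance (block_efficiency S istar t)"
      using variance_positive[of "block_efficiency S i t"] var by (rule le_less_trans)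
    then have bh: "0 < b * h_n ?n b"
      using n by (simp add: variance_block_efficiency[OF istar] b_def zero_less_divide_iff)
    then have nonzero: "b \<noteq> 0" "h_n ?n b \<noteq> 0"
      by auto
    have BE: "feedback_signal (outcomes S) (\<lambda>k. block_efficiency S k t) istar i = ereal x"
    proof -
      have "max (variance (block_efficiency S i t)) (variance (block_efficiency S istar t))
          = b * h_n ?n b / (real ?n)\<^sup>2"
        using var by (simp only: max_absorb2 less_imp_le variance_block_efficiency[OF istar] b_def)
      moreover have "expectation (block_efficiency S istar t) - expectation (block_efficiency S i t)
          = ((\<Sum>s = 1..?n. b ^ s) - (\<Sum>s = 1..?n. a ^ s)) / real ?n"
        by (simp only: expectation_block_efficiency drafter istar a_def b_def diff_divide_distrib)
      ultimately show ?thesis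
        unfolding feedback_signal_def using n nonzero by (simp add: x_def power_divide)
    qed
    have F: "0 \<le> (\<Sum>s = 1..?n. b ^ s) - (\<Sum>s = 1..?n. a ^ s)"
      using a ab by (simp add: sum_mono power_mono)
    \<comment> \<open>The assumption on \<open>h_n\<close> is cleared of denominators; multiplied by
      the squared gap, it bounds the square of the tangent estimate.\<close>
    have "(g_n ?n b)\<^sup>2 \<le> 4 * real ?n * (b * h_n ?n b)"
      using h b n by (simp add: field_simps)
    then have g: "((b - a) * g_n ?n b)\<^sup>2 \<le> 4 * (b - a)\<^sup>2 * real ?n * (b * h_n ?n b)"
      using mult_left_mono[of "(g_n ?n b)\<^sup>2" "4 * real ?n * (b * h_n ?n b)" "(b - a)\<^sup>2"]
      by (simp add: power_mult_distrib mult_ac)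
    have "((\<Sum>s = 1..?n. b ^ s) - (\<Sum>s = 1..?n. a ^ s))\<^sup>2 \<le> ((b - a) * g_n ?n b)\<^sup>2"
      by (intro power_mono power_sum_diff_le(1) F a ab)
    then have "x \<le> 4 * (b - a)\<^sup>2 * real ?n"
      using g bh by (simp add: x_def pos_divide_le_eq)
    then have "ereal x \<le> ereal ((b - a)\<^sup>2) / ereal v"
      using first by (meson ereal_less_eq(3) order_trans)
    \<comment> \<open>In the excluded case both rewards of \<open>istar\<close> have variance
      \<open>b * (1 - b)\<close>, the larger one by \<open>var\<close>, and the gaps agree as well,
      so the two signals coincide.\<close>
    moreover have "ereal x < ereal ((b - a)\<^sup>2) / ereal v"
      if strict: "\<not> (?n = 1 \<and> (AE y in rate_law S istar. y \<in> {0, 1}))"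
    proof (cases "?n = 1")
      case False
      then have "2 \<le> ?n"
        using n_max_pos by simp
      then have "((\<Sum>s = 1..?n. b ^ s) - (\<Sum>s = 1..?n. a ^ s))\<^sup>2 < ((b - a) * g_n ?n b)\<^sup>2"
        by (intro power_strict_mono power_sum_diff_le(2) F a ab) auto
      then have "x < 4 * (b - a)\<^sup>2 * real ?n"
        using g bh by (simp add: x_def pos_divide_less_eq)
      then show ?thesis
        using first by (meson ereal_less(2) less_ereal.simps(1) less_le_trans)
    next
      case True
      \<comment> \<open>For \<open>n = 1\<close>, \<open>h_n 1 b = 1 - b\<close> and the
        block-efficiency variances are \<open>a * (1 - a)\<close> and \<open>b * (1 - b)\<close>.
        Drafter \<open>istar\<close> stays below \<open>b * (1 - b)\<close> as its rates are not
        0-1-valued, drafter \<open>i\<close> by the comparison of variances.\<close>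
      have "rate_variance istar < b * (1 - b)"
        using rate_variance_le[OF istar] strict True by (auto simp: b_def order_less_le)
      moreover have "a * (1 - a) < b * (1 - b)"
        using var variance_block_efficiency[OF drafter, of t] variance_block_efficiency[OF istar, of t]
        by (simp only: True) (simp add: h_n_def a_def b_def)
      then have "rate_variance i < b * (1 - b)"
        using rate_variance_le(1)[OF drafter] by (simp add: a_def)
      ultimately have v_less: "v < b * (1 - b)"
        by (simp only: v_def variance_block_divergence[OF drafter] variance_block_divergence[OF istar]
            True of_nat_1 div_by_1 max_less_iff_conj simp_thms)
      have "x = (b - a)\<^sup>2 / (b * (1 - b))"
        by (simp add: x_def True h_n_def)
      then have "x * v < (b - a)\<^sup>2"
        using v v_less mult_strict_left_mono[OF v_less gap] by (simp add: pos_divide_less_eq)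
      then show ?thesis
        by (intro less_ereal_divide gap v)
    qed
    ultimately show ?thesis
      unfolding BE by blast
  qed
  show ?thesis
    using first second unfolding BD a_def b_def by blast
qed

end
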